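(* For infinitely many positive integers $n$ we have \[ b(n)<(2+o(1))n^{3/4}, \] where $o(1)$ denotes a quantity tending to $0$ as $n\to\infty$ along this infinite set of values of $n$.
   Context: All bipartite graphs are on a vertex set $A\cup B$ with fixed bipartition $(A,B)$ and $|A|=|B|=n$. For a bipartite graph $H$, $\overline{H}$ denotes its bipartite complement, i.e. the bipartite graph with edge set $\{ab: a\in A,\ b\in B,\ ab\notin E(H)\}$. A perfect matching $M$ in a bipartite graph $G$ is called acceptable for $H$ if no two edges of $M$ form a 4-cycle with two edges of $H$; that is, there are no two distinct edges $(a,b),(a',b')\in M$ with $a,a'\in A$, $b,b'\in B$ such that both $(a,b')$ and $(a',b)$ are edges of $H$. Define $b(n)$ to be the minimum number $s$ such that there exists an $s$-regular bipartite graph $H$ (with parts $A,B$ of size $n$) for which there is no perfect matching in $\overline{H}$ which is acceptable for $H$. *)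

theory Defs
  imports Complex_Main
begin

text \<open>
  A bipartite graph with fixed bipartition \<open>(A, B)\<close> is given by its edge set \<open>E \<subseteq> A \<times> B\<close>, the pair
  \<open>(a, b)\<close> standing for the edge joining \<open>a \<in> A\<close> to \<open>b \<in> B\<close>.  The side of a vertex is determined by
  its position in the pair, so \<open>A\<close> and \<open>B\<close> need not be disjoint as sets: the vertex set is the
  disjoint union of the two.
\<close>

definition bipartite_graph :: "'a set \<Rightarrow> 'b set \<Rightarrow> ('a \<times> 'b) set \<Rightarrow> bool" where
  "bipartite_graph A B E \<longleftrightarrow> E \<subseteq> A \<times> B"

definition bipartite_complement :: "'a set \<Rightarrow> 'b set \<Rightarrow> ('a \<times> 'b) set \<Rightarrow> ('a \<times> 'b) set" where
  "bipartite_complement A B E = {(a, b). a \<in> A \<and> b \<in> B \<and> (a, b) \<notin> E}"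

definition regular_bipartite_graph ::
    "'a set \<Rightarrow> 'b set \<Rightarrow> nat \<Rightarrow> ('a \<times> 'b) set \<Rightarrow> bool" where
  "regular_bipartite_graph A B s E \<longleftrightarrow>
     bipartite_graph A B E \<and>
     (\<forall>a\<in>A. card {b \<in> B. (a, b) \<in> E} = s) \<and>
     (\<forall>b\<in>B. card {a \<in> A. (a, b) \<in> E} = s)"

definition perfect_matching ::
    "'a set \<Rightarrow> 'b set \<Rightarrow> ('a \<times> 'b) set \<Rightarrow> ('a \<times> 'b) set \<Rightarrow> bool" where
  "perfect_matching A B G M \<longleftrightarrow>
     M \<subseteq> G \<and>
     (\<forall>a\<in>A. \<exists>!b. b \<in> B \<and> (a, b) \<in> M) \<and>
     (\<forall>b\<in>B. \<exists>!a. a \<in> A \<and> (a, b) \<in> M)"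

definition acceptable :: "('a \<times> 'b) set \<Rightarrow> ('a \<times> 'b) set \<Rightarrow> bool" where
  "acceptable H M \<longleftrightarrow>
     \<not> (\<exists>a b a' b'. (a, b) \<in> M \<and> (a', b') \<in> M \<and> (a, b) \<noteq> (a', b') \<and>
          (a, b') \<in> H \<and> (a', b) \<in> H)"

text \<open>
  Both parts are taken to be \<open>{..<n}\<close>; this loses nothing, as all notions above are invariant under
  relabelling the vertices within each part.  For \<open>n \<ge> 1\<close> the minimum is over a nonempty set:
  \<open>s = n\<close> qualifies, since the bipartite complement of the complete bipartite graph has no edges.
  For \<open>n = 0\<close> there is no such \<open>s\<close>, and the value is unspecified.
\<close>

definition b_min :: "nat \<Rightarrow> nat" where
  "b_min n = (LEAST s. \<exists>H. regular_bipartite_graph {..<n} {..<n} s H \<and>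
            \<not> (\<exists>M. perfect_matching {..<n} {..<n} (bipartite_complement {..<n} {..<n} H) M \<and>
                    acceptable H M))"

end

theory Submission
  imports Defs "HOL-Analysis.Convex" "HOL-Library.FuncSet"
begin

text \<open>
  The graph is a blow-up. Partition \<open>B\<close> into \<open>k\<close> groups of size \<open>g\<close>, give every \<open>a \<in> A\<close> a set \<open>N a\<close>
  of groups, and join \<open>a\<close> to all vertices of the groups in \<open>N a\<close>. A perfect matching \<open>M\<close> in the
  bipartite complement assigns to each group \<open>j\<close> the set \<open>F j\<close> of the \<open>g\<close> vertices of \<open>A\<close> that are
  matched into it. Draw an arc from \<open>i\<close> to \<open>j\<close> if some \<open>a \<in> F i\<close> has \<open>j \<in> N a\<close>; there are no loops,
  since \<open>M\<close> avoids the graph. A 2-cycle of this digraph yields two edges of \<open>M\<close> that form a 4-cycle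
  with two edges of the graph. If any \<open>g\<close> of the sets \<open>N a\<close> cover at least half of the groups, then
  every outdegree is at least \<open>k / 2\<close>, which is too much for a loopless digraph without 2-cycles
  (\<open>no_acceptable_matching_blow_up\<close>).

  Sets with this covering property come from a code. The groups are indexed by the points of
  \<open>{..<L} \<times> {..<q}\<close>, and the sets \<open>N a\<close> are the graphs of the functions \<open>x \<mapsto> (f x + c) mod q\<close>, where
  \<open>c < q\<close> and \<open>f\<close> runs through a family of \<open>L g\<close> functions. Because of the translations by \<open>c\<close>, every
  point lies on exactly \<open>L g\<close> of these graphs, so that the blow-up is regular of degree \<open>L g\<close>.
  A family in which any two different translates agree in at most \<open>w\<close> points is found greedily:
  by an exponential moment bound (\<open>card_functions_agreeing_often\<close>), few functions agree often with
  a given one. The Cauchy-Schwarz inequality turns small pairwise intersections into a large union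
  (\<open>card_Union_ge_of_small_intersections\<close>).

  With \<open>q = 8 r\<close>, \<open>L = q\<^sup>2\<close>, \<open>g = 8 q\<close> and \<open>w = 15 r\<close> this gives \<open>n = L q g = 8 q\<^sup>4\<close> and the degree
  \<open>L g = 8 q\<^sup>3\<close>, which is \<open>8 powr (1 / 4) < 2\<close> times \<open>n powr (3 / 4)\<close>. So the error term can be
  taken to be \<open>0\<close>.
\<close>

section \<open>Unions of sets with small pairwise intersections\<close>

lemma card_Union_ge_of_small_intersections:
  fixes N :: "'a \<Rightarrow> 'b set"
  assumes F: "finite F"
    and fin: "\<And>a. a \<in> F \<Longrightarrow> finite (N a)"
    and t: "\<And>a. a \<in> F \<Longrightarrow> card (N a) = t"
    and w: "\<And>a b. a \<in> F \<Longrightarrow> b \<in> F \<Longrightarrow> a \<noteq> b \<Longrightarrow> card (N a \<inter> N b) \<le> w"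
  shows "(card F * t)\<^sup>2 \<le> card (\<Union>a\<in>F. N a) * (card F * t + (card F)\<^sup>2 * w)"
proof -
  define U where "U = (\<Union>a\<in>F. N a)"
  have finU: "finite U"
    unfolding U_def using F fin by blast
  \<comment> \<open>The number of sets that contain a point: its first moment is the sum of the cardinalities,
    its second moment the sum of those of all pairwise intersections.\<close>
  define d :: "'b \<Rightarrow> nat" where "d p = (\<Sum>a\<in>F. of_bool (p \<in> N a))" for p
  have card_eq: "(\<Sum>p\<in>U. of_bool (p \<in> S)) = card S" if "S \<subseteq> U" for S
    using that finU by (simp add: sum_of_bool_eq Int_absorb1 Collect_conj_eq)
  have sum_d: "(\<Sum>p\<in>U. d p) = card F * t"
  proof -
    have "(\<Sum>p\<in>U. d p) = (\<Sum>a\<in>F. \<Sum>p\<in>U. of_bool (p \<in> N a))"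
      unfolding d_def by (rule sum.swap)
    also have "\<dots> = (\<Sum>a\<in>F. t)"
      by (intro sum.cong refl) (subst card_eq, auto simp: U_def t)
    finally show ?thesis by simp
  qed
  have sum_d2: "(\<Sum>p\<in>U. (d p)\<^sup>2) \<le> card F * t + (card F)\<^sup>2 * w"
  proof -
    have "(d p)\<^sup>2 = (\<Sum>a\<in>F. \<Sum>b\<in>F. of_bool (p \<in> N a \<inter> N b))" for p
      unfolding d_def power2_eq_square sum_product
      by (intro sum.cong refl) (simp add: of_bool_conj)
    then have "(\<Sum>p\<in>U. (d p)\<^sup>2) = (\<Sum>p\<in>U. \<Sum>a\<in>F. \<Sum>b\<in>F. of_bool (p \<in> N a \<inter> N b))"
      by simp
    also have "\<dots> = (\<Sum>a\<in>F. \<Sum>b\<in>F. \<Sum>p\<in>U. of_bool (p \<in> N a \<inter> N b))"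
      by (subst sum.swap, intro sum.cong refl, rule sum.swap)
    also have "\<dots> = (\<Sum>a\<in>F. \<Sum>b\<in>F. card (N a \<inter> N b))"
      by (intro sum.cong refl card_eq) (auto simp: U_def)
    also have "\<dots> \<le> (\<Sum>a\<in>F. \<Sum>b\<in>F. (if b = a then t else 0) + w)"
      by (intro sum_mono) (use w t in \<open>auto simp: eq_commute\<close>)
    also have "\<dots> = card F * t + (card F)\<^sup>2 * w"
      using F by (simp add: sum.distrib power2_eq_square algebra_simps)
    finally show ?thesis .
  qed
  have "(\<Sum>p\<in>U. real (d p))\<^sup>2 \<le> (\<Sum>p\<in>U. (real (d p))\<^sup>2) * card U"
    by (rule sum_squared_le_sum_of_squares)
  then have "real ((\<Sum>p\<in>U. d p)\<^sup>2) \<le> real ((\<Sum>p\<in>U. (d p)\<^sup>2) * card U)"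
    by simp
  then have "(\<Sum>p\<in>U. d p)\<^sup>2 \<le> (\<Sum>p\<in>U. (d p)\<^sup>2) * card U"
    by (simp only: of_nat_le_iff)
  also have "\<dots> \<le> (card F * t + (card F)\<^sup>2 * w) * card U"
    using sum_d2 by (rule mult_right_mono) simp
  finally show ?thesis
    unfolding sum_d unfolding U_def by (simp only: mult.commute)
qed

section \<open>Blow-ups without acceptable matchings\<close>

text \<open>
  A loopless digraph on \<open>K\<close>, with out-neighbourhoods \<open>Q i\<close>, has at most \<open>k (k - 1) / 2\<close> arcs if it has
  no 2-cycle, where \<open>k = card K\<close>.
\<close>

lemma two_cycle_if_outdegrees_ge_half:
  assumes K: "finite K" "K \<noteq> {}"
    and Q: "\<And>i. i \<in> K \<Longrightarrow> Q i \<subseteq> K - {i}"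
    and half: "\<And>i. i \<in> K \<Longrightarrow> card K \<le> 2 * card (Q i)"
  shows "\<exists>i\<in>K. \<exists>j\<in>K. j \<in> Q i \<and> i \<in> Q j"
proof (rule ccontr)
  assume no: "\<not> ?thesis"
  define D where "D = (SIGMA i:K. Q i)"
  have finQ: "finite (Q i)" if "i \<in> K" for i
    using Q[OF that] K(1) by (meson finite_Diff finite_subset)
  have finD: "finite D"
    unfolding D_def using K(1) finQ by blast
  have "card K * card K \<le> (\<Sum>i\<in>K. 2 * card (Q i))"
    using sum_mono[of K "\<lambda>_. card K" "\<lambda>i. 2 * card (Q i)"] half by simp
  also have "\<dots> = 2 * card D"
    unfolding D_def using K(1) finQ by (simp add: sum_distrib_left)
  also have "\<dots> = card D + card (D\<inverse>)"
    by (simp add: card_inverse)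
  also have "\<dots> = card (D \<union> D\<inverse>)"
  proof (rule card_Un_disjoint[symmetric])
    show "D \<inter> D\<inverse> = {}"
      using no Q unfolding D_def by blast
  qed (use finD in auto)
  also have "\<dots> < card (K \<times> K)"
  proof (rule psubset_card_mono)
    obtain i where "i \<in> K" using K(2) by blast
    then have "(i, i) \<in> K \<times> K" "(i, i) \<notin> D \<union> D\<inverse>"
      using Q unfolding D_def by auto
    moreover have "D \<union> D\<inverse> \<subseteq> K \<times> K"
      using Q unfolding D_def by blast
    ultimately show "D \<union> D\<inverse> \<subset> K \<times> K" by blast
  qed (use K(1) in simp)
  finally show False by (simp add: card_cartesian_product)
qed

text \<open>
  The bipartite graph in which \<open>a\<close> is joined to all vertices of \<open>B\<close> whose group lies in \<open>N a\<close>; the map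
  \<open>\<gamma>\<close> sends each vertex of \<open>B\<close> to its group.
\<close>

definition blow_up :: "'a set \<Rightarrow> 'b set \<Rightarrow> ('a \<Rightarrow> 'k set) \<Rightarrow> ('b \<Rightarrow> 'k) \<Rightarrow> ('a \<times> 'b) set" where
  "blow_up A B N \<gamma> = {(a, b). a \<in> A \<and> b \<in> B \<and> \<gamma> b \<in> N a}"

lemma regular_blow_up:
  assumes "finite B" "finite K"
    and \<gamma>: "\<And>j. j \<in> K \<Longrightarrow> card {b \<in> B. \<gamma> b = j} = g" "\<And>b. b \<in> B \<Longrightarrow> \<gamma> b \<in> K"
    and N: "\<And>a. a \<in> A \<Longrightarrow> N a \<subseteq> K" "\<And>a. a \<in> A \<Longrightarrow> card (N a) * g = s"
      "\<And>j. j \<in> K \<Longrightarrow> card {a \<in> A. j \<in> N a} = s"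
  shows "regular_bipartite_graph A B s (blow_up A B N \<gamma>)"
  unfolding regular_bipartite_graph_def
proof (intro conjI ballI)
  show "bipartite_graph A B (blow_up A B N \<gamma>)"
    by (auto simp: bipartite_graph_def blow_up_def)
next
  fix a assume a: "a \<in> A"
  have "{b \<in> B. (a, b) \<in> blow_up A B N \<gamma>} = (\<Union>j\<in>N a. {b \<in> B. \<gamma> b = j})"
    using a by (auto simp: blow_up_def)
  also have "card \<dots> = (\<Sum>j\<in>N a. card {b \<in> B. \<gamma> b = j})"
    by (rule card_UN_disjoint) (use assms(1,2) N(1)[OF a] in \<open>auto intro: finite_subset\<close>)
  also have "\<dots> = (\<Sum>j\<in>N a. g)"
    by (intro sum.cong refl \<gamma>(1)) (use N(1)[OF a] in blast)
  finally show "card {b \<in> B. (a, b) \<in> blow_up A B N \<gamma>} = s"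
    using N(2)[OF a] by simp
next
  fix b assume b: "b \<in> B"
  then have "{a \<in> A. (a, b) \<in> blow_up A B N \<gamma>} = {a \<in> A. \<gamma> b \<in> N a}"
    by (auto simp: blow_up_def)
  then show "card {a \<in> A. (a, b) \<in> blow_up A B N \<gamma>} = s"
    using N(3)[OF \<gamma>(2)[OF b]] by simp
qed

lemma no_acceptable_matching_blow_up:
  assumes K: "finite K" "K \<noteq> {}"
    and \<gamma>: "\<And>j. j \<in> K \<Longrightarrow> card {b \<in> B. \<gamma> b = j} = g"
    and N: "\<And>a. a \<in> A \<Longrightarrow> N a \<subseteq> K"
    and cover: "\<And>F. F \<subseteq> A \<Longrightarrow> card F = g \<Longrightarrow> card K \<le> 2 * card (\<Union>a\<in>F. N a)"
    and M: "perfect_matching A B (bipartite_complement A B (blow_up A B N \<gamma>)) M"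
  shows "\<not> acceptable (blow_up A B N \<gamma>) M"
proof -
  have MA: "\<exists>!b. b \<in> B \<and> (a, b) \<in> M" if "a \<in> A" for a
    using M that unfolding perfect_matching_def by blast
  have MB: "\<exists>!a. a \<in> A \<and> (a, b) \<in> M" if "b \<in> B" for b
    using M that unfolding perfect_matching_def by blast
  have M_sub: "a \<in> A" "b \<in> B" "\<gamma> b \<notin> N a" if "(a, b) \<in> M" for a b
    using M that unfolding perfect_matching_def bipartite_complement_def blow_up_def by auto
  \<comment> \<open>the vertices of \<open>A\<close> matched into group \<open>j\<close>\<close>
  define F where "F j = {a \<in> A. \<exists>b. (a, b) \<in> M \<and> \<gamma> b = j}" for j
  have card_F: "card (F j) = g" if j: "j \<in> K" for j
  proof -
    have "bij_betw (\<lambda>b. THE a. a \<in> A \<and> (a, b) \<in> M) {b \<in> B. \<gamma> b = j} (F j)"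
    proof (rule bij_betwI')
      fix b b' assume b: "b \<in> {b \<in> B. \<gamma> b = j}" "b' \<in> {b \<in> B. \<gamma> b = j}"
      show "((THE a. a \<in> A \<and> (a, b) \<in> M) = (THE a. a \<in> A \<and> (a, b') \<in> M)) = (b = b')"
        using theI'[OF MB, of b] theI'[OF MB, of b'] b MA by (auto, metis)
    next
      fix b assume b: "b \<in> {b \<in> B. \<gamma> b = j}"
      then show "(THE a. a \<in> A \<and> (a, b) \<in> M) \<in> F j"
        using theI'[OF MB, of b] unfolding F_def by blast
    next
      fix a assume "a \<in> F j"
      then obtain b where b: "a \<in> A" "(a, b) \<in> M" "\<gamma> b = j"
        unfolding F_def by blast
      then have "a = (THE a. a \<in> A \<and> (a, b) \<in> M)"
        using the1_equality[OF MB, of b a] M_sub(2) by auto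
      then show "\<exists>b\<in>{b \<in> B. \<gamma> b = j}. a = (THE a. a \<in> A \<and> (a, b) \<in> M)"
        using b M_sub(2) by blast
    qed
    from bij_betw_same_card[OF this] show ?thesis
      using \<gamma>[OF j] by simp
  qed
  have F_notin: "j \<notin> N a" if "a \<in> F j" for a j
    using that M_sub(3) unfolding F_def by blast
  have "\<exists>i\<in>K. \<exists>j\<in>K. j \<in> (\<Union>a\<in>F i. N a) \<and> i \<in> (\<Union>a\<in>F j. N a)"
  proof (rule two_cycle_if_outdegrees_ge_half[OF K])
    fix i assume "i \<in> K"
    show "(\<Union>a\<in>F i. N a) \<subseteq> K - {i}"
      using N F_notin unfolding F_def by blast
    show "card K \<le> 2 * card (\<Union>a\<in>F i. N a)"
      by (rule cover[OF _ card_F[OF \<open>i \<in> K\<close>]]) (auto simp: F_def)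
  qed
  then obtain i j a a' where ij: "a \<in> F i" "j \<in> N a" "a' \<in> F j" "i \<in> N a'"
    by blast
  then obtain b b' where bb': "(a, b) \<in> M" "\<gamma> b = i" "(a', b') \<in> M" "\<gamma> b' = j"
    unfolding F_def by blast
  moreover have "(a, b) \<noteq> (a', b')"
    using ij bb' F_notin by auto
  moreover have "(a, b') \<in> blow_up A B N \<gamma>" "(a', b) \<in> blow_up A B N \<gamma>"
    using ij bb' M_sub unfolding blow_up_def by auto
  ultimately show ?thesis
    unfolding acceptable_def by blast
qed

section \<open>Families of functions whose translates seldom agree\<close>

text \<open>
  An exponential moment bound: give each function the weight 2 to the power of its number of
  agreements with \<open>T\<close>. The total weight is a product over the points of \<open>X\<close>, and each factor is
  \<open>card Y + 1\<close>, the value of \<open>T\<close> counting twice.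
\<close>

lemma card_functions_agreeing_often:
  assumes X: "finite X" and Y: "finite Y"
    and T: "\<And>x. x \<in> X \<Longrightarrow> T x \<in> Y"
  shows "card {f \<in> X \<rightarrow>\<^sub>E Y. w < card {x \<in> X. f x = T x}} * 2 ^ w \<le> (card Y + 1) ^ card X"
proof -
  define agr where "agr f = card {x \<in> X. f x = T x}" for f
  have fin: "finite (X \<rightarrow>\<^sub>E Y)"
    using X Y by (intro finite_PiE) auto
  have "card {f \<in> X \<rightarrow>\<^sub>E Y. w < agr f} * 2 ^ w
      = (\<Sum>f\<in>{f \<in> X \<rightarrow>\<^sub>E Y. w < agr f}. (2::nat) ^ w)"
    by simp
  also have "\<dots> \<le> (\<Sum>f\<in>{f \<in> X \<rightarrow>\<^sub>E Y. w < agr f}. 2 ^ agr f)"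
    by (intro sum_mono power_increasing) auto
  also have "\<dots> \<le> (\<Sum>f\<in>X \<rightarrow>\<^sub>E Y. 2 ^ agr f)"
    by (intro sum_mono2 fin) auto
  also have "\<dots> = (\<Sum>f\<in>X \<rightarrow>\<^sub>E Y. \<Prod>x\<in>X. if f x = T x then 2 else 1)"
    using X by (intro sum.cong refl) (simp add: agr_def prod.If_cases Int_def)
  also have "\<dots> = (\<Prod>x\<in>X. \<Sum>y\<in>Y. if y = T x then 2 else 1)"
    by (rule prod_sum_PiE[symmetric]) (use X Y in auto)
  also have "\<dots> = (\<Prod>x\<in>X. card Y + 1)"
  proof (intro prod.cong refl)
    fix x assume "x \<in> X"
    have "(\<Sum>y\<in>Y. if y = T x then 2 else 1) = (\<Sum>y\<in>Y. (if y = T x then 1 else 0) + (1::nat))"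
      by (intro sum.cong) auto
    also have "\<dots> = card Y + 1"
      using Y T[OF \<open>x \<in> X\<close>] by (simp only: sum.distrib sum.delta) simp
    finally show "(\<Sum>y\<in>Y. if y = T x then 2 else 1) = card Y + (1::nat)" .
  qed
  finally show ?thesis
    by (simp add: agr_def)
qed

text \<open>
  The number of points of \<open>{..<L}\<close> at which the translates of \<open>f\<close> by \<open>c\<close> and of \<open>f'\<close> by \<open>c'\<close> agree
  modulo \<open>q\<close>.
\<close>

definition shift_agreement :: "nat \<Rightarrow> nat \<Rightarrow> (nat \<Rightarrow> nat) \<Rightarrow> nat \<Rightarrow> (nat \<Rightarrow> nat) \<Rightarrow> nat \<Rightarrow> nat" where
  "shift_agreement L q f c f' c' = card {x \<in> {..<L}. (f x + c) mod q = (f' x + c') mod q}"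

lemma card_functions_shift_agreeing_often:
  assumes "0 < q" "c < q"
  shows "card {f \<in> {..<L} \<rightarrow>\<^sub>E {..<q}. w < shift_agreement L q f c f' c'} * 2 ^ w \<le> (q + 1) ^ L"
proof -
  \<comment> \<open>The translates agree at \<open>x\<close> only if \<open>f\<close> takes one prescribed value there; adding \<open>q - c\<close>
    instead of subtracting \<open>c\<close> avoids truncated subtraction.\<close>
  define T where "T x = (f' x + c' + (q - c)) mod q" for x
  have agree: "f x = T x" if "f x < q" "(f x + c) mod q = (f' x + c') mod q" for f x
  proof -
    have "f x = (f x + c + (q - c)) mod q"
      using that(1) assms by simp
    also have "\<dots> = T x"
      unfolding T_def using that(2) by (metis mod_add_left_eq)
    finally show ?thesis .
  qed
  have "{f \<in> {..<L} \<rightarrow>\<^sub>E {..<q}. w < shift_agreement L q f c f' c'}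
      \<subseteq> {f \<in> {..<L} \<rightarrow>\<^sub>E {..<q}. w < card {x \<in> {..<L}. f x = T x}}"
  proof safe
    fix f assume f: "f \<in> {..<L} \<rightarrow>\<^sub>E {..<q}" "w < shift_agreement L q f c f' c'"
    have "shift_agreement L q f c f' c' \<le> card {x \<in> {..<L}. f x = T x}"
      unfolding shift_agreement_def using f(1) agree by (intro card_mono) auto
    then show "w < card {x \<in> {..<L}. f x = T x}"
      using f(2) by simp
  qed
  then have "card {f \<in> {..<L} \<rightarrow>\<^sub>E {..<q}. w < shift_agreement L q f c f' c'}
      \<le> card {f \<in> {..<L} \<rightarrow>\<^sub>E {..<q}. w < card {x \<in> {..<L}. f x = T x}}"
    by (rule card_mono[rotated]) (simp add: finite_PiE)
  also have "\<dots> * 2 ^ w \<le> (card {..<q} + 1) ^ card {..<L}"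
    by (rule card_functions_agreeing_often) (use assms in \<open>auto simp: T_def\<close>)
  finally show ?thesis by simp
qed

text \<open>
  Greedy choice: while fewer than \<open>m\<close> functions are chosen, the functions that agree too often with
  some translate of a chosen one do not exhaust all functions.
\<close>

lemma exists_family_small_shift_agreements:
  assumes q: "0 < q" and L: "w < L"
    and small: "m * q\<^sup>2 * (q + 1) ^ L < 2 ^ w * q ^ L"
  shows "\<exists>S. finite S \<and> card S = m \<and> S \<subseteq> {..<L} \<rightarrow>\<^sub>E {..<q} \<and>
    (\<forall>f\<in>S. \<forall>f'\<in>S. f \<noteq> f' \<longrightarrow> (\<forall>c<q. \<forall>c'<q. shift_agreement L q f c f' c' \<le> w))"
proof -
  have "\<exists>S. finite S \<and> card S = j \<and> S \<subseteq> {..<L} \<rightarrow>\<^sub>E {..<q} \<and>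
    (\<forall>f\<in>S. \<forall>f'\<in>S. f \<noteq> f' \<longrightarrow> (\<forall>c<q. \<forall>c'<q. shift_agreement L q f c f' c' \<le> w))"
    if "j \<le> m" for j
    using that
  proof (induction j)
    case 0
    show ?case by (intro exI[of _ "{}"]) auto
  next
    case (Suc j)
    then obtain S where S: "finite S" "card S = j" "S \<subseteq> {..<L} \<rightarrow>\<^sub>E {..<q}"
      and agr: "\<And>f f' c c'. f \<in> S \<Longrightarrow> f' \<in> S \<Longrightarrow> f \<noteq> f' \<Longrightarrow> c < q \<Longrightarrow> c' < q \<Longrightarrow>
        shift_agreement L q f c f' c' \<le> w"
      by (metis Suc_leD)
    define I where "I = S \<times> {..<q} \<times> {..<q}"
    define bad where "bad = (\<lambda>(f', c, c'). {f \<in> {..<L} \<rightarrow>\<^sub>E {..<q}. w < shift_agreement L q f c f' c'})"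
    have finI: "finite I" and cardI: "card I = j * q\<^sup>2"
      using S by (auto simp: I_def card_cartesian_product power2_eq_square)
    have fin_bad: "finite (\<Union>i\<in>I. bad i)"
      using finI by (auto simp: bad_def finite_PiE)
    have "card (\<Union>i\<in>I. bad i) * 2 ^ w \<le> (\<Sum>i\<in>I. card (bad i)) * 2 ^ w"
      by (intro mult_right_mono card_UN_le finI) simp
    also have "\<dots> \<le> (\<Sum>i\<in>I. (q + 1) ^ L)"
      unfolding sum_distrib_right
      by (intro sum_mono) (auto simp: I_def bad_def q intro: card_functions_shift_agreeing_often[simplified])
    also have "\<dots> = j * q\<^sup>2 * (q + 1) ^ L"
      by (simp add: cardI)
    also have "\<dots> \<le> m * q\<^sup>2 * (q + 1) ^ L"
      using Suc.prems by (intro mult_right_mono) auto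
    also have "\<dots> < card ({..<L} \<rightarrow>\<^sub>E {..<q}) * 2 ^ w"
      using small by (simp add: card_PiE mult.commute)
    finally have "card (\<Union>i\<in>I. bad i) < card ({..<L} \<rightarrow>\<^sub>E {..<q})"
      by simp
    then have "\<not> ({..<L} \<rightarrow>\<^sub>E {..<q}) \<subseteq> (\<Union>i\<in>I. bad i)"
      using card_mono[OF fin_bad] by (meson not_le)
    then obtain f where f: "f \<in> {..<L} \<rightarrow>\<^sub>E {..<q}" "f \<notin> (\<Union>i\<in>I. bad i)"
      by blast
    have new: "shift_agreement L q f c f' c' \<le> w" if "f' \<in> S" "c < q" "c' < q" for f' c c'
    proof -
      have "(f', c, c') \<in> I"
        using that by (simp add: I_def)
      then have "f \<notin> bad (f', c, c')"
        using f(2) by blast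
      then show ?thesis
        using f(1) by (simp add: bad_def)
    qed
    have sym: "shift_agreement L q f' c' f c = shift_agreement L q f c f' c'" for f' c c'
      by (simp add: shift_agreement_def eq_commute)
    \<comment> \<open>A function agrees with itself in \<open>L > w\<close> points, so the new one was not chosen before.\<close>
    have "f \<notin> S"
    proof
      assume "f \<in> S"
      then have "shift_agreement L q f 0 f 0 \<le> w"
        using new q by blast
      then show False
        using L by (simp add: shift_agreement_def)
    qed
    moreover have "shift_agreement L q f1 c f2 c' \<le> w"
      if "f1 \<in> insert f S" "f2 \<in> insert f S" "f1 \<noteq> f2" "c < q" "c' < q" for f1 f2 c c'
      using that agr[of f1 f2 c c'] new[of f2 c c'] new[of f1 c' c] sym[of f1 c c'] by auto
    ultimately show ?case
      using S f(1) by (intro exI[of _ "insert f S"] conjI ballI impI allI) simp_all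
  qed
  then show ?thesis by blast
qed


section \<open>The resulting bounds for the minimum degree\<close>

text \<open>
  The assumption \<open>small\<close> lets the greedy choice produce \<open>L * g\<close> functions; by the assumption \<open>half\<close>,
  the lower bound on the union of \<open>g\<close> graphs of functions is at least half of the \<open>L * q\<close> points.
\<close>

lemma b_min_le:
  assumes "0 < q" and wL: "w < L" and "0 < g"
    and small: "L * g * q\<^sup>2 * (q + 1) ^ L < 2 ^ w * q ^ L"
    and half: "q * (L + g * w) \<le> 2 * g * L"
  shows "b_min (L * q * g) \<le> L * g"
proof -
  obtain S where S: "finite S" "card S = L * g" "S \<subseteq> {..<L} \<rightarrow>\<^sub>E {..<q}"
    and agr: "\<And>f f' c c'. f \<in> S \<Longrightarrow> f' \<in> S \<Longrightarrow> f \<noteq> f' \<Longrightarrow> c < q \<Longrightarrow> c' < q \<Longrightarrow>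
        shift_agreement L q f c f' c' \<le> w"
    using exists_family_small_shift_agreements[OF \<open>0 < q\<close> wL small] by metis
  define n where "n = L * q * g"
  define K where "K = {..<L} \<times> {..<q}"
  have finK: "finite K" and cardK: "card K = L * q" and neK: "K \<noteq> {}"
    using assms by (auto simp: K_def card_cartesian_product)
  obtain \<alpha> where \<alpha>: "bij_betw \<alpha> {..<n} (S \<times> {..<q})"
    using finite_same_card_bij[of "{..<n}" "S \<times> {..<q}"] S
    by (auto simp: n_def card_cartesian_product mult_ac)
  obtain \<beta> where \<beta>: "bij_betw \<beta> {..<n} (K \<times> {..<g})"
    using finite_same_card_bij[of "{..<n}" "K \<times> {..<g}"] finK
    by (auto simp: n_def card_cartesian_product cardK)
  \<comment> \<open>The vertices of \<open>A\<close> stand for the translated functions, those of \<open>B\<close> for the elements of \<open>g\<close>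
    copies of the point set \<open>K\<close>.\<close>
  define \<gamma> where "\<gamma> b = fst (\<beta> b)" for b
  define G where "G = (\<lambda>(f, c). (\<lambda>x. (x, (f x + c) mod q)) ` {..<L})"
  define N where "N a = G (\<alpha> a)" for a
  have S_less: "f x < q" if "f \<in> S" "x < L" for f x
    using S(3) that by fastforce
  have \<alpha>_mem: "\<alpha> a \<in> S \<times> {..<q}" if "a < n" for a
    using \<alpha> that by (auto simp: bij_betw_def)
  have G_sub: "G i \<subseteq> K" for i
    using \<open>0 < q\<close> by (auto simp: G_def K_def split: prod.split)
  have finG: "finite (G i)" for i
    using G_sub finK by (rule finite_subset)
  have card_G: "card (G i) = L" for i
    by (auto simp: G_def inj_on_def card_image split: prod.split)
  have card_G_inter: "card (G i \<inter> G i') \<le> w"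
    if "i \<in> S \<times> {..<q}" "i' \<in> S \<times> {..<q}" "i \<noteq> i'" for i i'
  proof -
    obtain f c f' c' where i: "i = (f, c)" "i' = (f', c')" by fastforce
    have "G i \<inter> G i' = (\<lambda>x. (x, (f x + c) mod q)) ` {x \<in> {..<L}. (f x + c) mod q = (f' x + c') mod q}"
      by (auto simp: G_def i)
    then have le: "card (G i \<inter> G i') \<le> shift_agreement L q f c f' c'"
      unfolding shift_agreement_def by (simp add: card_image_le)
    show ?thesis
    proof (cases "f = f'")
      case True
      have cancel: "d = (f x + d + (q - f x)) mod q" if "x < L" "d < q" for x d
        using S_less[of f x] that \<open>i \<in> S \<times> {..<q}\<close> i by simp
      have "(f x + c) mod q \<noteq> (f x + c') mod q" if "x < L" for x
        using cancel[OF \<open>x < L\<close>, of c] cancel[OF \<open>x < L\<close>, of c'] \<open>i \<noteq> i'\<close> True i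
          \<open>i \<in> S \<times> {..<q}\<close> \<open>i' \<in> S \<times> {..<q}\<close>
        by (metis SigmaD2 lessThan_iff mod_add_left_eq)
      then have "shift_agreement L q f c f' c' = 0"
        using True by (simp add: shift_agreement_def)
      then show ?thesis using le by simp
    next
      case False
      then show ?thesis using le agr[of f f' c c'] that i by auto
    qed
  qed
  have deg: "card {i \<in> S \<times> {..<q}. p \<in> G i} = L * g" if pK: "p \<in> K" for p
  proof -
    obtain x y where p: "p = (x, y)" "x < L" "y < q"
      using pK unfolding K_def by blast
    \<comment> \<open>Each \<open>f \<in> S\<close> has exactly one translate whose graph passes through \<open>p\<close>.\<close>
    have solve: "(f x + c) mod q = y \<longleftrightarrow> c = (y + (q - f x)) mod q" if "f \<in> S" "c < q" for f c
    proof -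
      have fx: "f x < q" using S_less that(1) p(2) by simp
      have "c = (f x + c + (q - f x)) mod q" "y = (y + (q - f x) + f x) mod q"
        using fx that(2) p(3) by auto
      then show ?thesis
        by (metis add.commute mod_add_left_eq)
    qed
    have "p \<in> G (f, c) \<longleftrightarrow> c = (y + (q - f x)) mod q" if "f \<in> S" "c < q" for f c
      using solve[OF that] p by (auto simp: G_def)
    then have "{i \<in> S \<times> {..<q}. p \<in> G i} = (\<lambda>f. (f, (y + (q - f x)) mod q)) ` S"
      using \<open>0 < q\<close> by auto
    then show ?thesis
      by (simp add: card_image inj_on_def S(2))
  qed
  have \<gamma>: "card {b \<in> {..<n}. \<gamma> b = j} = g" if "j \<in> K" for j
  proof -
    have "\<beta> ` {b \<in> {..<n}. \<gamma> b = j} = {u \<in> \<beta> ` {..<n}. fst u = j}"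
      unfolding \<gamma>_def by auto
    also have "\<dots> = {j} \<times> {..<g}"
      using that bij_betw_imp_surj_on[OF \<beta>] by auto
    finally have "card (\<beta> ` {b \<in> {..<n}. \<gamma> b = j}) = g"
      by (simp add: card_cartesian_product)
    moreover have "inj_on \<beta> {b \<in> {..<n}. \<gamma> b = j}"
      using bij_betw_imp_inj_on[OF \<beta>] by (rule inj_on_subset) auto
    ultimately show ?thesis
      by (simp add: card_image)
  qed
  have \<gamma>_mem: "\<gamma> b \<in> K" if "b \<in> {..<n}" for b
    using bij_betw_apply[OF \<beta> that] by (auto simp: \<gamma>_def)
  have regular: "regular_bipartite_graph {..<n} {..<n} (L * g) (blow_up {..<n} {..<n} N \<gamma>)"
  proof (rule regular_blow_up[OF finite_lessThan finK \<gamma> \<gamma>_mem])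
    show "card {a \<in> {..<n}. j \<in> N a} = L * g" if "j \<in> K" for j
    proof -
      have "\<alpha> ` {a \<in> {..<n}. j \<in> N a} = {i \<in> \<alpha> ` {..<n}. j \<in> G i}"
        unfolding N_def by auto
      then have "card (\<alpha> ` {a \<in> {..<n}. j \<in> N a}) = L * g"
        using deg[OF that] by (simp only: bij_betw_imp_surj_on[OF \<alpha>])
      moreover have "inj_on \<alpha> {a \<in> {..<n}. j \<in> N a}"
        using bij_betw_imp_inj_on[OF \<alpha>] by (rule inj_on_subset) auto
      ultimately show ?thesis
        by (simp add: card_image)
    qed
  qed (use G_sub in \<open>auto simp: N_def card_G\<close>)
  have cover: "card K \<le> 2 * card (\<Union>a\<in>F. N a)" if F: "F \<subseteq> {..<n}" "card F = g" for F
  proof (rule ccontr)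
    assume "\<not> ?thesis"
    then have less: "2 * card (\<Union>a\<in>F. N a) < L * q"
      by (simp add: cardK)
    have "2 * (g * L)\<^sup>2 \<le> 2 * (card (\<Union>a\<in>F. N a) * (g * L + g\<^sup>2 * w))"
    proof (rule mult_left_mono)
      show "(g * L)\<^sup>2 \<le> card (\<Union>a\<in>F. N a) * (g * L + g\<^sup>2 * w)"
        unfolding F(2)[symmetric]
      proof (rule card_Union_ge_of_small_intersections)
        fix a b assume "a \<in> F" "b \<in> F" "a \<noteq> b"
        then have "a \<in> {..<n}" "b \<in> {..<n}" "\<alpha> a \<noteq> \<alpha> b"
          using F(1) \<alpha> by (auto simp: bij_betw_def inj_on_def)
        then show "card (N a \<inter> N b) \<le> w"
          unfolding N_def by (intro card_G_inter \<alpha>_mem) auto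
      qed (use F finite_subset[OF F(1)] in \<open>auto simp: N_def card_G finG\<close>)
    qed simp
    also have "\<dots> < L * q * (g * L + g\<^sup>2 * w)"
      using mult_strict_right_mono[OF less, of "g * L + g\<^sup>2 * w"] assms(3) wL
      by (simp add: mult_ac)
    also have "\<dots> = g * L * (q * (L + g * w))"
      by (simp add: power2_eq_square algebra_simps)
    also have "\<dots> \<le> g * L * (2 * g * L)"
      using half by (rule mult_left_mono) simp
    also have "\<dots> = 2 * (g * L)\<^sup>2"
      by (simp add: power2_eq_square)
    finally show False by simp
  qed
  have "\<not> (\<exists>M. perfect_matching {..<n} {..<n}
      (bipartite_complement {..<n} {..<n} (blow_up {..<n} {..<n} N \<gamma>)) M \<and>
      acceptable (blow_up {..<n} {..<n} N \<gamma>) M)"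
    using no_acceptable_matching_blow_up[OF finK neK \<gamma> _ cover] G_sub
    by (metis N_def)
  with regular show ?thesis
    unfolding b_min_def n_def[symmetric] by (intro Least_le) blast
qed

lemma Suc_power_le_three_mult_power:
  fixes q :: nat
  assumes "0 < q"
  shows "(q + 1) ^ q \<le> 3 * q ^ q"
proof -
  have "(1 + 1 / real q) ^ q \<le> exp 1"
    using exp_ge_one_plus_x_over_n_power_n[of q 1] assms by simp
  also have "\<dots> \<le> 3" by (rule exp_le)
  finally have "(1 + 1 / real q) ^ q * real q ^ q \<le> 3 * real q ^ q"
    by (rule mult_right_mono) simp
  also have "(1 + 1 / real q) ^ q * real q ^ q = real (q + 1) ^ q"
    using assms by (simp add: field_simps flip: power_mult_distrib)
  finally have "real ((q + 1) ^ q) \<le> real (3 * q ^ q)"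
    by simp
  then show ?thesis
    by (simp only: of_nat_le_iff)
qed

text \<open>
  The threshold suffices because \<open>20 ^ 5 < 2 ^ 22\<close>, and because passing from \<open>r\<close> to \<open>r + 1\<close> multiplies
  \<open>r ^ 5\<close> by at most \<open>(21 / 20) ^ 5 < 4\<close>.
\<close>

lemma power5_less_four_power:
  assumes "20 \<le> r"
  shows "2 ^ 18 * r ^ 5 < (4::nat) ^ r"
  using assms
proof (induction r rule: dec_induct)
  case base
  show ?case by simp
next
  case (step r)
  have "(20 * Suc r) ^ 5 \<le> (21 * r) ^ 5"
    using step.hyps by (intro power_mono) auto
  then have "20 ^ 5 * Suc r ^ 5 \<le> 21 ^ 5 * r ^ 5"
    by (simp only: power_mult_distrib)
  then have "Suc r ^ 5 \<le> 4 * r ^ 5"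
    by simp
  then have "2 ^ 18 * Suc r ^ 5 \<le> 4 * (2 ^ 18 * r ^ 5)"
    by simp
  also have "\<dots> < 4 * 4 ^ r"
    using step.IH by simp
  finally show ?case by simp
qed

lemma b_min_le_eight_cubes:
  assumes r: "20 \<le> r"
  defines "q \<equiv> 8 * r"
  shows "b_min (8 * q ^ 4) \<le> 8 * q ^ 3"
proof -
  have q: "0 < q" using r by (simp add: q_def)
  have "b_min (q\<^sup>2 * q * (8 * q)) \<le> q\<^sup>2 * (8 * q)"
  proof (rule b_min_le[where w = "15 * r"])
    show "15 * r < q\<^sup>2"
      using r by (simp add: q_def power2_eq_square)
    show "q * (q\<^sup>2 + 8 * q * (15 * r)) \<le> 2 * (8 * q) * q\<^sup>2"
      by (simp add: q_def power2_eq_square)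
    \<comment> \<open>The bases are \<open>6561 = 3 ^ 8\<close> and \<open>32768 = 2 ^ 15\<close>; a factor of \<open>4 ^ r\<close> is left to absorb the
      polynomial factor.\<close>
    have "q\<^sup>2 * (8 * q) * q\<^sup>2 = 8 * q ^ 5"
      by algebra
    also have "\<dots> = 2 ^ 18 * r ^ 5"
      by (simp add: q_def power_mult_distrib)
    finally have "q\<^sup>2 * (8 * q) * q\<^sup>2 * 3 ^ q = 2 ^ 18 * r ^ 5 * 6561 ^ r"
      by (simp add: q_def power_mult)
    also have "\<dots> < 4 ^ r * 6561 ^ r"
      using power5_less_four_power[OF r] by simp
    also have "\<dots> = 26244 ^ r"
      by (simp flip: power_mult_distrib)
    also have "\<dots> \<le> 32768 ^ r"
      by (intro power_mono) auto
    also have "\<dots> = 2 ^ (15 * r)"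
      by (simp add: power_mult)
    finally have less: "q\<^sup>2 * (8 * q) * q\<^sup>2 * 3 ^ q < 2 ^ (15 * r)" .
    have "(q + 1) ^ q\<^sup>2 = ((q + 1) ^ q) ^ q"
      by (simp add: power2_eq_square power_mult)
    also have "\<dots> \<le> (3 * q ^ q) ^ q"
      by (intro power_mono Suc_power_le_three_mult_power q) simp
    also have "\<dots> = 3 ^ q * q ^ q\<^sup>2"
      by (simp add: power2_eq_square power_mult power_mult_distrib)
    finally have "q\<^sup>2 * (8 * q) * q\<^sup>2 * (q + 1) ^ q\<^sup>2 \<le> q\<^sup>2 * (8 * q) * q\<^sup>2 * (3 ^ q * q ^ q\<^sup>2)"
      by (rule mult_left_mono) simp
    also have "\<dots> = q\<^sup>2 * (8 * q) * q\<^sup>2 * 3 ^ q * q ^ q\<^sup>2"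
      by (simp only: mult.assoc)
    also have "\<dots> < 2 ^ (15 * r) * q ^ q\<^sup>2"
      by (rule mult_strict_right_mono[OF less]) (use q in simp)
    finally show "q\<^sup>2 * (8 * q) * q\<^sup>2 * (q + 1) ^ q\<^sup>2 < 2 ^ (15 * r) * q ^ q\<^sup>2" .
  qed (use q in auto)
  moreover have "q\<^sup>2 * q * (8 * q) = 8 * q ^ 4" "q\<^sup>2 * (8 * q) = 8 * q ^ 3"
    by algebra+
  ultimately show ?thesis
    by simp
qed

lemma eight_cubes_less_powr:
  fixes q :: real
  assumes "0 < q"
  shows "8 * q ^ 3 < 2 * (8 * q ^ 4) powr (3 / 4)"
proof (rule power_less_imp_less_base)
  have "((8 * q ^ 4) powr (3 / 4)) ^ 4 = (8 * q ^ 4) ^ 3"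
    using assms by (subst powr_power) simp_all
  then have "(2 * (8 * q ^ 4) powr (3 / 4)) ^ 4 = 2 ^ 4 * (8 * q ^ 4) ^ 3"
    by (simp only: power_mult_distrib)
  moreover have "(8 * q ^ 3) ^ 4 = 4096 * q ^ 12" "2 ^ 4 * (8 * q ^ 4) ^ 3 = 8192 * q ^ 12"
    by (simp_all add: power_mult_distrib)
  ultimately show "(8 * q ^ 3) ^ 4 < (2 * (8 * q ^ 4) powr (3 / 4)) ^ 4"
    using assms by simp
qed simp

theorem theorem8:
  "\<exists>(N :: nat set) (\<epsilon> :: nat \<Rightarrow> real).
     infinite N \<and> (\<forall>n\<in>N. n > 0) \<and>
     (\<epsilon> \<longlongrightarrow> 0) (inf sequentially (principal N)) \<and>
     (\<forall>n\<in>N. real (b_min n) < (2 + \<epsilon> n) * real n powr (3 / 4))"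
proof (intro exI conjI)
  define h :: "nat \<Rightarrow> nat" where "h r = 8 * (8 * r) ^ 4" for r
  show "infinite (h ` {20..})"
  proof -
    have "inj_on h {20..}"
      by (auto simp: h_def inj_on_def power_eq_iff_eq_base)
    then show ?thesis
      by (simp add: finite_image_iff infinite_Ici)
  qed
  show "\<forall>n\<in>h ` {20..}. n > 0"
    by (auto simp: h_def)
  show "((\<lambda>_. 0) \<longlongrightarrow> (0::real)) (inf sequentially (principal (h ` {20..})))"
    by simp
  show "\<forall>n\<in>h ` {20..}. real (b_min n) < (2 + 0) * real n powr (3 / 4)"
  proof
    fix n assume "n \<in> h ` {20..}"
    then obtain r where r: "20 \<le> r" "n = 8 * (8 * r) ^ 4"
      by (auto simp: h_def)
    have "real (b_min n) \<le> real (8 * (8 * r) ^ 3)"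
      unfolding r(2) of_nat_le_iff by (rule b_min_le_eight_cubes[OF r(1)])
    also have "\<dots> < 2 * real n powr (3 / 4)"
      using eight_cubes_less_powr[of "real (8 * r)"] r by simp
    finally show "real (b_min n) < (2 + 0) * real n powr (3 / 4)"
      by simp
  qed
qed

end
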